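(* Let $G$ be a simple graph with vertex set $V(G)=\{v_1,\dots,v_n\}$, $n\ge 1$, and $m$ edges, let $S\subseteq V(G)$ with $|S|=\sigma$, and let $G_S$ be the graph obtained from $G$ by attaching one self-loop at each vertex of $S$. Then $$E(G_S)=\sqrt{n\left(2m+\sigma-\frac{\sigma^2}{n}\right)}$$ if and only if $G_S$ is one of the following: $nK_1$ or $\frac{n}{2}K_2$ (when $\sigma=0$); $\frac{n}{2}K_1\cup\frac{n}{2}\widehat{K_1}$ or $\frac{n}{2}\widetilde{K_2}$ (when $\sigma=\frac{n}{2}$); $n\widehat{K_1}$ or $\frac{n}{2}\widehat{K_2}$ (when $\sigma=n$). (Graphs with a coefficient $\frac{n}{2}$ occur only for $n$ even.)
   Context: The adjacency matrix $A(G_S)=[a_{ij}]$ is the $n\times n$ symmetric $0/1$ matrix with, for $i\ne j$, $a_{ij}=1$ iff $v_i,v_j$ are adjacent, and $a_{ii}=1$ iff $v_i\in S$; its eigenvalues $\lambda_1,\dots,\lambda_n$ are the adjacency eigenvalues of $G_S$. The energy is $E(G_S)=\sum_{i=1}^n\left|\lambda_i-\frac{\sigma}{n}\right|$. Here $m$ counts only edges of $G$ (not loops). $kH$ denotes the disjoint union of $k$ copies of $H$. $\widehat{K_1}$ is a single vertex with a self-loop, $\widehat{K_2}$ is $K_2$ with a self-loop at both vertices, and $\widetilde{K_2}$ is $K_2$ with a self-loop at exactly one vertex. *)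

theory Defs
  imports
    Complex_Main
    "Graph_Theory.Pair_Digraph"
    "Graph_Theory.Digraph_Isomorphism"
    "Jordan_Normal_Form.Char_Poly"
begin

text \<open>
  A finite simple graph is a \<^locale>\<open>pair_graph\<close>: a symmetric, loop-free arc relation on a
  finite vertex set. A self-loop at \<open>x\<close> is the single arc \<open>(x, x)\<close>.
\<close>

definition attach_loops :: "'a pair_pre_digraph \<Rightarrow> 'a set \<Rightarrow> 'a pair_pre_digraph" where
  "attach_loops G S = \<lparr>pverts = pverts G, parcs = parcs G \<union> Id_on S\<rparr>"

text \<open>Each undirected edge \<open>{x, y}\<close> is represented by two arcs but counted once.\<close>

definition num_edges :: "'a pair_pre_digraph \<Rightarrow> nat" where
  "num_edges G = card ((\<lambda>(x, y). {x, y}) ` parcs G)"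

text \<open>
  Matrix indices start at 0, so the vertices are enumerated as \<open>v 0, \<dots>, v (n - 1)\<close>.
\<close>

definition adjacency_matrix :: "(nat \<Rightarrow> 'a) \<Rightarrow> 'a pair_pre_digraph \<Rightarrow> real mat" where
  "adjacency_matrix v H =
     mat (card (pverts H)) (card (pverts H)) (\<lambda>(i, j). if (v i, v j) \<in> parcs H then 1 else 0)"

text \<open>
  The adjacency matrix is real symmetric, so its characteristic polynomial splits over the reals
  and the multiset of its real roots consists of all \<open>n\<close> eigenvalues, with multiplicity.
\<close>

definition eigenvalues_mset :: "real mat \<Rightarrow> real multiset" where
  "eigenvalues_mset A = proots (char_poly A)"

definition loop_energy :: "(nat \<Rightarrow> 'a) \<Rightarrow> 'a pair_pre_digraph \<Rightarrow> 'a set \<Rightarrow> real" where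
  "loop_energy v G S =
     (\<Sum>x \<in># eigenvalues_mset (adjacency_matrix v (attach_loops G S)).
        \<bar>x - real (card S) / real (card (pverts G))\<bar>)"

lemma adjacency_matrix_attach_loops:
  assumes "pair_graph G" "S \<subseteq> pverts G" "bij_betw v {..<n} (pverts G)" "i < n" "j < n"
  shows "adjacency_matrix v (attach_loops G S) $$ (i, j) =
    (if i = j then (if v i \<in> S then 1 else 0) else (if (v i, v j) \<in> parcs G then 1 else 0))"
proof -
  interpret pair_graph G by fact
  have n: "card (pverts G) = n"
    using bij_betw_same_card[OF assms(3)] by simp
  have "v i = v j \<longleftrightarrow> i = j"
    using assms(3-5) by (auto simp: bij_betw_def inj_on_def)
  moreover have "(v i, v i) \<notin> parcs G"
    using no_loops' by blast
  ultimately show ?thesis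
    using assms(4,5) by (auto simp: adjacency_matrix_def attach_loops_def n)
qed

definition graph_copies :: "nat \<Rightarrow> 'a pair_pre_digraph \<Rightarrow> (nat \<times> 'a) pair_pre_digraph" where
  "graph_copies k H =
     \<lparr>pverts = {..<k} \<times> pverts H,
      parcs = {((i, x), (i, y)) | i x y. i < k \<and> (x, y) \<in> parcs H}\<rparr>"

definition graph_disjoint_union ::
  "'a pair_pre_digraph \<Rightarrow> 'b pair_pre_digraph \<Rightarrow> ('a + 'b) pair_pre_digraph" where
  "graph_disjoint_union G H =
     \<lparr>pverts = pverts G <+> pverts H,
      parcs = map_prod Inl Inl ` parcs G \<union> map_prod Inr Inr ` parcs H\<rparr>"

definition graph_iso :: "'a pair_pre_digraph \<Rightarrow> 'b pair_pre_digraph \<Rightarrow> bool" where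
  "graph_iso G H \<longleftrightarrow> digraph_iso (with_proj G) (with_proj H)"

definition K1 :: "nat pair_pre_digraph" where
  "K1 = \<lparr>pverts = {0}, parcs = {}\<rparr>"

definition K2 :: "nat pair_pre_digraph" where
  "K2 = \<lparr>pverts = {0, 1}, parcs = {(0, 1), (1, 0)}\<rparr>"

definition K1_hat :: "nat pair_pre_digraph" where
  "K1_hat = attach_loops K1 {0}"

definition K2_hat :: "nat pair_pre_digraph" where
  "K2_hat = attach_loops K2 {0, 1}"

definition K2_tilde :: "nat pair_pre_digraph" where
  "K2_tilde = attach_loops K2 {0}"

end

theory Submission
  imports Defs "Jordan_Normal_Form.Schur_Decomposition" "Jordan_Normal_Form.Jordan_Normal_Form_Uniqueness"
begin

text \<open>
  Put \<open>s = \<sigma> / n\<close>. The eigenvalues satisfy \<open>(\<Sum>i. (\<lambda>\<^sub>i - s)\<^sup>2) = tr ((A - s I)\<^sup>2) = 2 m + \<sigma> - \<sigma>\<^sup>2 / n\<close>,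
  so the claimed value of the energy is the Cauchy-Schwarz bound, attained iff all \<open>\<bar>\<lambda>\<^sub>i - s\<bar>\<close> agree,
  that is, iff \<open>A\<^sup>2 = 2 s A + c I\<close> for some \<open>c\<close>. Read entrywise, this equation prescribes the numbers of
  common neighbours in \<open>G\<^sub>S\<close>, and it forces \<open>G\<close> to be edgeless or a perfect matching.
\<close>

section \<open>Eigenvalues of real symmetric matrices\<close>

text \<open>Eigenvalues and the labelling \<open>v\<close> are needed only up to
  \<open>energy_eq_iff_quadratic_graph\<close>. There the matrix equation becomes a condition on
  numbers of common neighbours, which isomorphisms preserve, so the converse direction requires no
  spectrum of any listed graph. The condition is local to connected components, but \<open>s\<close>
  and \<open>c\<close> are global: all components must satisfy it with the same pair, and
  \<open>s\<close> is the proportion of looped vertices. This is where the list comes from. An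
  isolated bare vertex demands c = 0 and an isolated looped one c = 1 - 2 s, so the two kinds occur
  together only for s = 1/2. The ends of an edge without further neighbours have as many common
  neighbours as there are loops at them; this number is 2 s, so all edges of a perfect matching
  carry the same number of loops, namely 0, 1 or 2.\<close>

definition trace_mat :: "'a :: comm_ring_1 mat \<Rightarrow> 'a" where
  "trace_mat A = (\<Sum>i<dim_row A. A $$ (i, i))"

lemma index_mult_mat_sum:
  assumes "A \<in> carrier_mat n n" "B \<in> carrier_mat n n" "i < n" "j < n"
  shows "(A * B) $$ (i, j) = (\<Sum>k<n. A $$ (i, k) * B $$ (k, j))"
  using assms by (auto simp: scalar_prod_def lessThan_atLeast0 intro!: sum.cong)

lemma trace_mat_mult_commute:
  assumes "A \<in> carrier_mat n n" "B \<in> carrier_mat n n"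
  shows "trace_mat (A * B) = trace_mat (B * A)"
proof -
  have "trace_mat (A * B) = (\<Sum>i<n. \<Sum>k<n. A $$ (i, k) * B $$ (k, i))"
    using assms by (auto simp: trace_mat_def index_mult_mat_sum[OF assms] simp del: index_mult_mat(1) intro!: sum.cong)
  also have "\<dots> = (\<Sum>k<n. \<Sum>i<n. B $$ (k, i) * A $$ (i, k))"
    by (subst sum.swap) (simp add: mult.commute)
  also have "\<dots> = trace_mat (B * A)"
    using assms by (auto simp: trace_mat_def index_mult_mat_sum[OF assms(2,1)] simp del: index_mult_mat(1) intro!: sum.cong)
  finally show ?thesis .
qed

lemma trace_mat_similar:
  assumes "similar_mat_wit A B P Q"
  shows "trace_mat A = trace_mat B"
proof -
  define n where "n = dim_row A"
  have A: "A \<in> carrier_mat n n"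
    by (rule similar_mat_witD(4)[OF n_def assms])
  note w = similar_mat_witD2[OF A assms]
  have "trace_mat (P * B * Q) = trace_mat (Q * (P * B))"
    using w(5-7) by (intro trace_mat_mult_commute[of _ n]) auto
  also have "Q * (P * B) = Q * P * B"
    by (rule assoc_mult_mat[OF w(7,6,5), symmetric])
  also have "\<dots> = B"
    unfolding w(2) by (rule left_mult_one_mat[OF w(5)])
  finally show ?thesis
    by (simp only: w(3)[symmetric])
qed

text \<open>The inner factors \<open>Q * P\<close> cancel. The point is that the witnesses stay the
  same, so a single triangularisation of a matrix serves every polynomial in it.\<close>

lemma similar_mat_wit_mult:
  assumes "similar_mat_wit A B P Q" "similar_mat_wit A' B' P Q" "dim_row A = dim_row A'"
  shows "similar_mat_wit (A * A') (B * B') P Q"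
proof -
  define n where "n = dim_row A"
  have A: "A \<in> carrier_mat n n"
    by (rule similar_mat_witD(4)[OF n_def assms(1)])
  have A': "A' \<in> carrier_mat n n"
    by (rule similar_mat_witD(4)[OF n_def[unfolded assms(3)] assms(2)])
  note w = similar_mat_witD2[OF A assms(1)] and w' = similar_mat_witD2[OF A' assms(2)]
  have cancel: "Q * (P * X) = X" if "X \<in> carrier_mat n n" for X
    unfolding assoc_mult_mat[OF w(7,6) that, symmetric] w(2) by (rule left_mult_one_mat[OF that])
  note [simp] = w(5-7) w'(5) mult_carrier_mat[of _ n n _ n] assoc_mult_mat[of _ n n _ n _ n]
  have "A * A' = P * B * Q * (P * B' * Q)"
    by (simp only: w(3)[symmetric] w'(3)[symmetric])
  also have "\<dots> = P * (B * B') * Q"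
    by (simp add: cancel)
  finally show ?thesis
    using w(1,2) by (intro similar_mat_witI[of _ _ n]) (auto simp: w(4) w'(4))
qed

text \<open>A summand survives only if i \<le> k \<le> j, which for j \<le> i leaves at most k = i =
  j. Hence squaring a triangular matrix squares its diagonal, that is, its eigenvalues.\<close>

lemma upper_triangular_mult_index:
  fixes A B :: "'a :: comm_ring_1 mat"
  assumes "A \<in> carrier_mat n n" "B \<in> carrier_mat n n" "upper_triangular A" "upper_triangular B"
    and "i < n" "j \<le> i"
  shows "(A * B) $$ (i, j) = (if i = j then A $$ (i, i) * B $$ (i, i) else 0)"
proof -
  have "(A * B) $$ (i, j) = (\<Sum>k<n. A $$ (i, k) * B $$ (k, j))"
    using assms by (intro index_mult_mat_sum) auto
  also have "\<dots> = (\<Sum>k<n. if k = i then (if i = j then A $$ (i, i) * B $$ (i, i) else 0) else 0)"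
  proof (intro sum.cong refl)
    fix k assume "k \<in> {..<n}"
    then consider "k < i" | "k = i" | "k > i" "j < k" "k < n"
      using assms by force
    then show "A $$ (i, k) * B $$ (k, j) =
        (if k = i then (if i = j then A $$ (i, i) * B $$ (i, i) else 0) else 0)"
      using assms by cases (auto simp: upper_triangularD)
  qed
  also have "\<dots> = (if i = j then A $$ (i, i) * B $$ (i, i) else 0)"
    using assms by simp
  finally show ?thesis .
qed

lemma upper_triangular_mult:
  fixes A B :: "'a :: comm_ring_1 mat"
  assumes "A \<in> carrier_mat n n" "B \<in> carrier_mat n n" "upper_triangular A" "upper_triangular B"
  shows "upper_triangular (A * B)"
  using upper_triangular_mult_index[OF assms] assms(1) by (intro upper_triangularI) auto

lemma char_matrix_index:
  assumes "A \<in> carrier_mat n n" "i < n" "j < n"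
  shows "char_matrix A e $$ (i, j) = A $$ (i, j) - (if i = j then e else 0)"
  using assms by (auto simp: char_matrix_def)

lemma upper_triangular_char_matrix:
  assumes "A \<in> carrier_mat n n" "upper_triangular A"
  shows "upper_triangular (char_matrix A e)"
proof (rule upper_triangularI)
  fix i j assume "j < i" "i < dim_row (char_matrix A e)"
  moreover from this have "i < n"
    using char_matrix_closed[OF assms(1), of e] by simp
  ultimately show "char_matrix A e $$ (i, j) = 0"
    using assms by (simp add: char_matrix_index upper_triangularD)
qed

section \<open>Real spectrum of a symmetric matrix\<close>

lemma real_symmetric_char_poly_root_real:
  fixes A :: "real mat"
  assumes A: "A \<in> carrier_mat n n" and sym: "\<And>i j. i < n \<Longrightarrow> j < n \<Longrightarrow> A $$ (i, j) = A $$ (j, i)"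
    and root: "poly (char_poly (map_mat complex_of_real A)) z = 0"
  shows "z \<in> \<real>"
proof -
  let ?A = "map_mat complex_of_real A"
  have A': "?A \<in> carrier_mat n n"
    using A by simp
  from root have "eigenvalue ?A z"
    by (simp add: eigenvalue_root_char_poly[OF A'])
  then obtain w where w: "w \<in> carrier_vec n" "w \<noteq> 0\<^sub>v n" "?A *\<^sub>v w = z \<cdot>\<^sub>v w"
    using A by (auto simp: eigenvalue_def eigenvector_def)
  have Aw: "(\<Sum>j<n. of_real (A $$ (i, j)) * w $ j) = z * w $ i" if "i < n" for i
  proof -
    have "(?A *\<^sub>v w) $ i = (\<Sum>j<n. of_real (A $$ (i, j)) * w $ j)"
      using that A w(1) by (auto simp: scalar_prod_def lessThan_atLeast0 intro!: sum.cong)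
    then show ?thesis
      using that w(1) by (simp add: w(3))
  qed
  \<comment> \<open>\<open>q\<close> is the Hermitian form of \<open>A\<close> at the eigenvector
    \<open>w\<close>. The eigenvalue equation gives \<open>q = z * N\<close> with N > 0 the squared
    norm of \<open>w\<close>, and symmetry gives \<open>cnj q = q\<close>; so \<open>z\<close> is a
    quotient of reals.\<close>
  define q where "q = (\<Sum>i<n. \<Sum>j<n. of_real (A $$ (i, j)) * (cnj (w $ i) * w $ j))"
  define N where "N = (\<Sum>i<n. (cmod (w $ i))\<^sup>2)"
  have "q = (\<Sum>i<n. cnj (w $ i) * (\<Sum>j<n. of_real (A $$ (i, j)) * w $ j))"
    unfolding q_def by (simp add: sum_distrib_left algebra_simps)
  also have "\<dots> = (\<Sum>i<n. z * of_real ((cmod (w $ i))\<^sup>2))"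
    by (intro sum.cong refl) (simp add: Aw complex_norm_square mult.left_commute mult.commute[of "cnj _"] del: of_real_power)
  finally have q: "q = z * of_real N"
    by (simp add: N_def sum_distrib_left)
  have "cnj q = (\<Sum>i<n. \<Sum>j<n. of_real (A $$ (j, i)) * (cnj (w $ j) * w $ i))"
    unfolding q_def by (auto simp: algebra_simps sym intro!: sum.cong)
  also have "\<dots> = q"
    unfolding q_def by (rule sum.swap)
  finally have "q \<in> \<real>"
    by (simp add: Reals_cnj_iff)
  moreover obtain i where "i < n" "w $ i \<noteq> 0"
    using w by (metis carrier_vecD eq_vecI index_zero_vec(1,2))
  then have "N > 0"
    unfolding N_def by (intro sum_pos2[of _ i]) auto
  ultimately show ?thesis
    using q by (metis Reals_divide Reals_of_real less_irrefl nonzero_mult_div_cancel_right of_real_eq_0_iff)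
qed

text \<open>Over the complex numbers the polynomial splits, and all its roots are real. The product
  over their real parts is therefore mapped to the same complex polynomial, and the embedding of
  real polynomials is injective.\<close>

lemma real_symmetric_char_poly_factorized:
  fixes A :: "real mat"
  assumes A: "A \<in> carrier_mat n n" and sym: "\<And>i j. i < n \<Longrightarrow> j < n \<Longrightarrow> A $$ (i, j) = A $$ (j, i)"
  shows "\<exists>es. char_poly A = (\<Prod>a\<leftarrow>es. [:- a, 1:]) \<and> length es = n"
proof -
  let ?A = "map_mat complex_of_real A"
  have A': "?A \<in> carrier_mat n n"
    using A by simp
  obtain zs where zs: "char_poly ?A = (\<Prod>a\<leftarrow>zs. [:- a, 1:])" "length zs = n"
    using char_poly_factorized[OF A'] by blast
  have "z \<in> \<real>" if "z \<in> set zs" for z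
  proof (rule real_symmetric_char_poly_root_real[OF A sym])
    show "poly (char_poly ?A) z = 0"
      using that by (auto simp: zs poly_prod_list prod_list_zero_iff)
  qed
  then have re: "map (complex_of_real \<circ> Re) zs = zs"
    by (intro map_idI) auto
  interpret map_poly_inj_comm_ring_hom complex_of_real ..
  have "map_poly complex_of_real (\<Prod>a\<leftarrow>map Re zs. [:- a, 1:]) =
      (\<Prod>a\<leftarrow>map (complex_of_real \<circ> Re) zs. [:- a, 1:])"
    by (simp add: hom_prod_list o_def)
  also have "\<dots> = map_poly complex_of_real (char_poly A)"
    unfolding re zs(1)[symmetric] by (rule of_real_hom.char_poly_hom[OF A])
  finally have "char_poly A = (\<Prod>a\<leftarrow>map Re zs. [:- a, 1:])"
    by simp
  with zs show ?thesis
    by (metis length_map)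
qed

text \<open>Equality case of Cauchy-Schwarz, proved through a variance: with \<open>a\<close> the
  mean of the absolute values, equality says that their squared deviations from \<open>a\<close> sum
  to 0.\<close>

lemma sum_abs_eq_sqrt_iff:
  fixes f :: "nat \<Rightarrow> real"
  assumes "n \<ge> 1"
  shows "(\<Sum>i<n. \<bar>f i\<bar>) = sqrt (n * (\<Sum>i<n. (f i)\<^sup>2)) \<longleftrightarrow> (\<exists>c. \<forall>i<n. (f i)\<^sup>2 = c)"
proof
  assume eq: "(\<Sum>i<n. \<bar>f i\<bar>) = sqrt (n * (\<Sum>i<n. (f i)\<^sup>2))"
  define a where "a = (\<Sum>i<n. \<bar>f i\<bar>) / n"
  have sq: "(\<Sum>i<n. (f i)\<^sup>2) = n * a\<^sup>2"
    using assms eq by (simp add: a_def power_divide sum_nonneg power2_eq_square)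
  have "(\<Sum>i<n. (\<bar>f i\<bar> - a)\<^sup>2) = (\<Sum>i<n. (f i)\<^sup>2) - 2 * a * (\<Sum>i<n. \<bar>f i\<bar>) + n * a\<^sup>2"
    by (simp add: power2_diff sum.distrib sum_subtractf sum_distrib_left algebra_simps)
  also have "(\<Sum>i<n. \<bar>f i\<bar>) = n * a"
    using assms by (simp add: a_def)
  finally have "(\<Sum>i<n. (\<bar>f i\<bar> - a)\<^sup>2) = 0"
    using sq by (simp add: power2_eq_square)
  then have "\<forall>i<n. \<bar>f i\<bar> = a"
    by (subst (asm) sum_nonneg_eq_0_iff) auto
  then show "\<exists>c. \<forall>i<n. (f i)\<^sup>2 = c"
    by (metis power2_abs)
next
  assume "\<exists>c. \<forall>i<n. (f i)\<^sup>2 = c"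
  then obtain c where c: "\<And>i. i < n \<Longrightarrow> (f i)\<^sup>2 = c"
    by blast
  then have "\<bar>f i\<bar> = sqrt c" if "i < n" for i
    using that by (metis real_sqrt_abs)
  then have "(\<Sum>i<n. \<bar>f i\<bar>) = n * sqrt c"
    by simp
  also have "\<dots> = sqrt (n * (n * c))"
    by (simp add: real_sqrt_mult)
  also have "n * c = (\<Sum>i<n. (f i)\<^sup>2)"
    using c by simp
  finally show "(\<Sum>i<n. \<bar>f i\<bar>) = sqrt (n * (\<Sum>i<n. (f i)\<^sup>2))" .
qed

section \<open>Eigenvalue deviations and the Frobenius norm\<close>

lemma symmetric_mat_mult:
  fixes A :: "'a :: comm_ring_1 mat"
  assumes "A \<in> carrier_mat n n" "\<And>i j. i < n \<Longrightarrow> j < n \<Longrightarrow> A $$ (i, j) = A $$ (j, i)"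
    and "i < n" "j < n"
  shows "(A * A) $$ (i, j) = (A * A) $$ (j, i)"
  unfolding index_mult_mat_sum[OF assms(1,1,3,4)] index_mult_mat_sum[OF assms(1,1,4,3)]
  by (intro sum.cong refl) (use assms in \<open>auto simp: mult.commute\<close>)

lemma trace_mat_symmetric_square:
  fixes A :: "'a :: comm_ring_1 mat"
  assumes "A \<in> carrier_mat n n" "\<And>i j. i < n \<Longrightarrow> j < n \<Longrightarrow> A $$ (i, j) = A $$ (j, i)"
  shows "trace_mat (A * A) = (\<Sum>i<n. \<Sum>j<n. (A $$ (i, j))\<^sup>2)"
proof -
  have "trace_mat (A * A) = (\<Sum>i<n. (A * A) $$ (i, i))"
    using assms by (simp add: trace_mat_def)
  also have "\<dots> = (\<Sum>i<n. \<Sum>j<n. (A $$ (i, j))\<^sup>2)"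
    by (intro sum.cong refl)
      (simp add: index_mult_mat_sum[OF assms(1,1)] power2_eq_square assms(2) del: index_mult_mat(1))
  finally show ?thesis .
qed

lemma sum_list_singleton_mset: "(\<Sum>x\<leftarrow>xs. {#x#}) = mset xs"
  by (induction xs) auto

text \<open>
  A triangularisation over the reals suffices in place of an orthogonal diagonalisation: if all
  \<open>(\<lambda> - s)\<^sup>2\<close> equal \<open>c\<close>, the symmetric matrix \<open>(A - s)\<^sup>2 - c\<close> has only zero eigenvalues, so the
  trace of its square, which is the sum of its squared entries, vanishes.
\<close>

lemma symmetric_eigenvalue_deviation:
  fixes A :: "real mat" and s :: real
  assumes A: "A \<in> carrier_mat n n" and sym: "\<And>i j. i < n \<Longrightarrow> j < n \<Longrightarrow> A $$ (i, j) = A $$ (j, i)"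
    and n: "n \<ge> 1"
  defines "M \<equiv> char_matrix A s"
  shows "(\<Sum>x\<in>#eigenvalues_mset A. \<bar>x - s\<bar>) = sqrt (n * (\<Sum>i<n. \<Sum>j<n. (M $$ (i, j))\<^sup>2)) \<longleftrightarrow>
    (\<exists>c. \<forall>i<n. \<forall>j<n. (M * M) $$ (i, j) = (if i = j then c else 0))"
proof -
  obtain es where es: "char_poly A = (\<Prod>a\<leftarrow>es. [:- a, 1:])" "length es = n"
    using real_symmetric_char_poly_factorized[OF A sym] by blast
  obtain T P Q where "schur_decomposition A es = (T, P, Q)"
    by (cases "schur_decomposition A es") auto
  from schur_decomposition[OF A es(1) this]
  have wit: "similar_mat_wit A T P Q" and T: "upper_triangular T" and diag: "diag_mat T = es"
    by auto
  note [simp] = similar_mat_witD2(5)[OF A wit]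
  have Tii: "T $$ (i, i) = es ! i" if "i < n" for i
    using that es(2) by (auto simp: diag[symmetric] diag_mat_def)
  define U where "U = char_matrix T s"
  have M: "M \<in> carrier_mat n n" "\<And>i j. i < n \<Longrightarrow> j < n \<Longrightarrow> M $$ (i, j) = M $$ (j, i)"
    using A sym by (auto simp: M_def char_matrix_index[OF A])
  have U: "U \<in> carrier_mat n n" "upper_triangular U"
    by (auto simp: U_def intro: upper_triangular_char_matrix[of T n] T)
  have Uii: "U $$ (i, i) = es ! i - s" if "i < n" for i
    using that by (simp add: U_def char_matrix_index[of _ n] Tii)
  have witM: "similar_mat_wit (M * M) (U * U) P Q"
    using similar_mat_wit_char_matrix[OF wit, of s] unfolding M_def U_def by (intro similar_mat_wit_mult refl)
  have UUii: "(U * U) $$ (i, i) = (es ! i - s)\<^sup>2" if "i < n" for i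
    using that by (subst upper_triangular_mult_index[OF U(1,1,2,2)]) (auto simp: Uii power2_eq_square)
  have "trace_mat (M * M) = (\<Sum>i<n. (es ! i - s)\<^sup>2)"
    unfolding trace_mat_similar[OF witM] using U
    by (auto simp: trace_mat_def UUii simp del: index_mult_mat(1) intro!: sum.cong)
  \<comment> \<open>Both sides are the trace of \<open>M * M\<close>: the left one by symmetry of
    \<open>M\<close>, the right one through the triangular form. This makes the square root in the
    claim the Cauchy-Schwarz bound for the deviations \<open>es ! i - s\<close>.\<close>
  then have norm: "(\<Sum>i<n. \<Sum>j<n. (M $$ (i, j))\<^sup>2) = (\<Sum>i<n. (es ! i - s)\<^sup>2)"
    by (simp add: trace_mat_symmetric_square[OF M])
  have "proots (\<Prod>a\<leftarrow>es. [:- a, 1:]) = mset es"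
    using proots_prod_list[of "map (\<lambda>a. [:- a, 1:]) es"]
    by (simp add: o_def sum_list_singleton_mset image_iff)
  then have "(\<Sum>x\<in>#eigenvalues_mset A. \<bar>x - s\<bar>) = (\<Sum>x\<leftarrow>es. \<bar>x - s\<bar>)"
    by (simp add: eigenvalues_mset_def es flip: mset_map sum_mset_sum_list)
  also have "\<dots> = (\<Sum>i<n. \<bar>es ! i - s\<bar>)"
    by (simp add: sum_list_sum_nth es lessThan_atLeast0)
  finally have energy: "(\<Sum>x\<in>#eigenvalues_mset A. \<bar>x - s\<bar>) = sqrt (n * (\<Sum>i<n. \<Sum>j<n. (M $$ (i, j))\<^sup>2)) \<longleftrightarrow>
      (\<exists>c. \<forall>i<n. (es ! i - s)\<^sup>2 = c)"
    using sum_abs_eq_sqrt_iff[OF n] by (simp add: norm)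
  have "(\<forall>i<n. (es ! i - s)\<^sup>2 = c) \<longleftrightarrow> (\<forall>i<n. \<forall>j<n. (M * M) $$ (i, j) = (if i = j then c else 0))" for c
  proof -
    define N where "N = char_matrix (M * M) c"
    define V where "V = char_matrix (U * U) c"
    have MM: "M * M \<in> carrier_mat n n" and UU: "U * U \<in> carrier_mat n n"
      using M U by auto
    have N: "N \<in> carrier_mat n n" "\<And>i j. i < n \<Longrightarrow> j < n \<Longrightarrow> N $$ (i, j) = N $$ (j, i)"
      using MM symmetric_mat_mult[OF M] by (auto simp: N_def char_matrix_index[OF MM] simp del: index_mult_mat(1))
    have V: "V \<in> carrier_mat n n" "upper_triangular V"
      using UU by (auto simp: V_def intro: upper_triangular_char_matrix[OF UU] upper_triangular_mult[OF U(1,1,2,2)])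
    have Vii: "V $$ (i, i) = (es ! i - s)\<^sup>2 - c" if "i < n" for i
      using that by (simp add: V_def char_matrix_index[OF UU] UUii del: index_mult_mat(1))
    have "similar_mat_wit (N * N) (V * V) P Q"
      using similar_mat_wit_char_matrix[OF witM, of c] unfolding N_def V_def by (intro similar_mat_wit_mult refl)
    then have "trace_mat (N * N) = trace_mat (V * V)"
      by (rule trace_mat_similar)
    also have "\<dots> = (\<Sum>i<n. ((es ! i - s)\<^sup>2 - c)\<^sup>2)"
      using V by (auto simp: trace_mat_def Vii upper_triangular_mult_index[OF V(1,1,2,2)] power2_eq_square
          simp del: index_mult_mat(1) intro!: sum.cong)
    finally have "(\<Sum>i<n. \<Sum>j<n. (N $$ (i, j))\<^sup>2) = (\<Sum>i<n. ((es ! i - s)\<^sup>2 - c)\<^sup>2)"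
      by (simp add: trace_mat_symmetric_square[OF N])
    then have "(\<Sum>i<n. \<Sum>j<n. (N $$ (i, j))\<^sup>2) = 0 \<longleftrightarrow> (\<Sum>i<n. ((es ! i - s)\<^sup>2 - c)\<^sup>2) = 0"
      by simp
    then have "(\<forall>i<n. \<forall>j<n. N $$ (i, j) = 0) \<longleftrightarrow> (\<forall>i<n. (es ! i - s)\<^sup>2 = c)"
      by (auto simp: sum_nonneg_eq_0_iff sum_nonneg)
    then show ?thesis
      by (auto simp: N_def char_matrix_index[OF MM] simp del: index_mult_mat(1))
  qed
  then show ?thesis
    unfolding energy by blast
qed

section \<open>Graph isomorphism and copies of small graphs\<close>

text \<open>A library isomorphism maps vertices and arcs separately. Here arcs are pairs with tail
  \<open>fst\<close> and head \<open>snd\<close> on both sides, so the arc map is forced to be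
  \<open>map_prod f f\<close>, and only the vertex map carries information.\<close>

lemma graph_isoE:
  assumes "graph_iso G H" "parcs G \<subseteq> pverts G \<times> pverts G"
  obtains f where "bij_betw f (pverts G) (pverts H)"
    "\<And>x y. x \<in> pverts G \<Longrightarrow> y \<in> pverts G \<Longrightarrow> (x, y) \<in> parcs G \<longleftrightarrow> (f x, f y) \<in> parcs H"
proof -
  obtain h where h: "pre_digraph.digraph_isomorphism (with_proj G) h" "with_proj H = app_iso h (with_proj G)"
    using assms(1) by (auto simp: graph_iso_def digraph_iso_def)
  let ?f = "iso_verts h"
  have inj: "inj_on ?f (pverts G)"
    using h(1) by (auto simp: pre_digraph.digraph_isomorphism_def)
  have H: "pverts H = ?f ` pverts G" "parcs H = iso_arcs h ` parcs G" "fst = iso_tail h" "snd = iso_head h"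
    using h(2) by (auto simp: with_proj_def app_iso_def)
  have "\<forall>a\<in>parcs G. ?f (fst a) = fst (iso_arcs h a) \<and> ?f (snd a) = snd (iso_arcs h a)"
    using h(1) by (simp add: pre_digraph.digraph_isomorphism_def H(3,4))
  then have "iso_arcs h (x, y) = (?f x, ?f y)" if "(x, y) \<in> parcs G" for x y
    using that by (metis fst_conv snd_conv prod.collapse)
  then have arcs: "parcs H = map_prod ?f ?f ` parcs G"
    unfolding H(2) by (intro image_cong) auto
  have "(x, y) \<in> parcs G \<longleftrightarrow> (?f x, ?f y) \<in> parcs H" if "x \<in> pverts G" "y \<in> pverts G" for x y
  proof
    assume "(?f x, ?f y) \<in> parcs H"
    then obtain x' y' where "(x', y') \<in> parcs G" "?f x = ?f x'" "?f y = ?f y'"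
      by (auto simp: arcs)
    moreover from this have "x' = x" "y' = y"
      using that assms(2) inj by (auto dest: inj_onD)
    ultimately show "(x, y) \<in> parcs G"
      by simp
  qed (force simp: arcs)
  then show ?thesis
    using that inj H(1) by (auto simp: bij_betw_def)
qed

lemma graph_isoI:
  assumes "parcs G \<subseteq> pverts G \<times> pverts G" "parcs H \<subseteq> pverts H \<times> pverts H"
    and "bij_betw f (pverts G) (pverts H)"
    and "\<And>x y. x \<in> pverts G \<Longrightarrow> y \<in> pverts G \<Longrightarrow> (x, y) \<in> parcs G \<longleftrightarrow> (f x, f y) \<in> parcs H"
  shows "graph_iso G H"
proof -
  let ?h = "\<lparr>iso_verts = f, iso_arcs = map_prod f f, iso_head = snd, iso_tail = fst\<rparr>"
  have inj: "inj_on f (pverts G)" and img: "f ` pverts G = pverts H"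
    using assms(3) by (auto simp: bij_betw_def)
  have "inj_on (map_prod f f) (parcs G)"
    using map_prod_inj_on[OF inj inj] assms(1) by (rule inj_on_subset)
  moreover have "wf_digraph (with_proj G)"
    using assms(1) by unfold_locales auto
  ultimately have "pre_digraph.digraph_isomorphism (with_proj G) ?h"
    using inj by (auto simp: pre_digraph.digraph_isomorphism_def)
  moreover have "map_prod f f ` parcs G = parcs H"
  proof
    show "map_prod f f ` parcs G \<subseteq> parcs H"
      using assms(1,4) by auto
    show "parcs H \<subseteq> map_prod f f ` parcs G"
    proof
      fix e assume "e \<in> parcs H"
      then have "e \<in> f ` pverts G \<times> f ` pverts G"
        using assms(2) img by auto
      then obtain x y where "e = (f x, f y)" "x \<in> pverts G" "y \<in> pverts G"
        by blast
      with \<open>e \<in> parcs H\<close> assms(4) show "e \<in> map_prod f f ` parcs G"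
        by force
    qed
  qed
  then have "with_proj H = app_iso ?h (with_proj G)"
    by (simp add: with_proj_def app_iso_def img)
  ultimately show ?thesis
    by (auto simp: graph_iso_def digraph_iso_def)
qed

text \<open>A looped vertex is its own neighbour. For a symmetric arc relation this makes the number
  of common neighbours of two vertices the corresponding entry of the squared adjacency matrix,
  loops included.\<close>

definition nbrs :: "'a pair_pre_digraph \<Rightarrow> 'a \<Rightarrow> 'a set" where
  "nbrs G x = {y \<in> pverts G. (x, y) \<in> parcs G}"

text \<open>
  In terms of the adjacency matrix \<open>A\<close>, this says \<open>A\<^sup>2 = 2 s A + c I\<close>.
\<close>

definition quadratic_graph :: "real \<Rightarrow> real \<Rightarrow> 'a pair_pre_digraph \<Rightarrow> bool" where
  "quadratic_graph s c G \<longleftrightarrow> (\<forall>x\<in>pverts G. \<forall>y\<in>pverts G.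
     real (card (nbrs G x \<inter> nbrs G y)) = 2 * s * of_bool ((x, y) \<in> parcs G) + (if x = y then c else 0))"

lemma quadratic_graph_iso:
  assumes "graph_iso G H" "parcs G \<subseteq> pverts G \<times> pverts G" "quadratic_graph s c H"
  shows "quadratic_graph s c G"
  unfolding quadratic_graph_def
proof (intro ballI)
  fix x y assume xy: "x \<in> pverts G" "y \<in> pverts G"
  obtain f where f: "bij_betw f (pverts G) (pverts H)"
    "\<And>x y. x \<in> pverts G \<Longrightarrow> y \<in> pverts G \<Longrightarrow> (x, y) \<in> parcs G \<longleftrightarrow> (f x, f y) \<in> parcs H"
    using graph_isoE[OF assms(1,2)] by blast
  then have inj: "inj_on f (pverts G)" and img: "f ` pverts G = pverts H"
    by (auto simp: bij_betw_def)
  have "nbrs H (f x) \<inter> nbrs H (f y) = f ` (nbrs G x \<inter> nbrs G y)"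
    using xy f(2) unfolding nbrs_def img[symmetric] by blast
  moreover have "inj_on f (nbrs G x \<inter> nbrs G y)"
    using inj by (rule inj_on_subset) (auto simp: nbrs_def)
  ultimately have "card (nbrs G x \<inter> nbrs G y) = card (nbrs H (f x) \<inter> nbrs H (f y))"
    by (simp add: card_image)
  moreover have "f x = f y \<longleftrightarrow> x = y" "f x \<in> pverts H" "f y \<in> pverts H"
    using xy inj img by (auto dest: inj_onD)
  ultimately show "real (card (nbrs G x \<inter> nbrs G y)) =
      2 * s * of_bool ((x, y) \<in> parcs G) + (if x = y then c else 0)"
    using assms(3) f(2)[OF xy] by (simp add: quadratic_graph_def)
qed

section \<open>The quadratic condition under copies and disjoint unions\<close>

lemma in_parcs_graph_copies:
  "(z, w) \<in> parcs (graph_copies k G) \<longleftrightarrow> fst z = fst w \<and> fst z < k \<and> (snd z, snd w) \<in> parcs G"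
  by (cases z; cases w) (auto simp: graph_copies_def)

lemma quadratic_graph_copies:
  assumes "quadratic_graph s c G"
  shows "quadratic_graph s c (graph_copies k G)"
proof -
  have nbrs: "nbrs (graph_copies k G) (i, x) = {i} \<times> nbrs G x" if "i < k" for i x
    using that by (auto simp: nbrs_def graph_copies_def)
  have int: "{i} \<times> X \<inter> {j} \<times> Y = (if i = j then {i} \<times> (X \<inter> Y) else {})" for i j :: nat and X Y :: "'a set"
    by auto
  have verts: "pverts (graph_copies k G) = {..<k} \<times> pverts G"
    by (simp add: graph_copies_def)
  have G: "real (card (nbrs G x \<inter> nbrs G y)) = 2 * s * of_bool ((x, y) \<in> parcs G) + (if x = y then c else 0)"
    if "x \<in> pverts G" "y \<in> pverts G" for x y
    using assms that by (simp add: quadratic_graph_def)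
  show ?thesis
    unfolding quadratic_graph_def verts
  proof (intro ballI)
    fix z w assume "z \<in> {..<k} \<times> pverts G" "w \<in> {..<k} \<times> pverts G"
    then show "real (card (nbrs (graph_copies k G) z \<inter> nbrs (graph_copies k G) w)) =
        2 * s * of_bool ((z, w) \<in> parcs (graph_copies k G)) + (if z = w then c else 0)"
      by (cases z; cases w; cases "fst z = fst w")
        (simp_all add: nbrs int in_parcs_graph_copies G card_cartesian_product_singleton)
  qed
qed

text \<open>The adjacency matrix is block diagonal: vertices from different parts are not adjacent
  and share no neighbour, so both sides vanish there. The diagonal blocks have to agree on
  \<open>s\<close> and \<open>c\<close>.\<close>

lemma quadratic_graph_disjoint_union:
  assumes "quadratic_graph s c G" "quadratic_graph s c H"
  shows "quadratic_graph s c (graph_disjoint_union G H)"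
proof -
  let ?U = "graph_disjoint_union G H"
  have nbrs: "nbrs ?U (Inl x) = Inl ` nbrs G x" "nbrs ?U (Inr y) = Inr ` nbrs H y" for x y
    by (auto simp: nbrs_def graph_disjoint_union_def)
  have int: "Inl ` X \<inter> Inl ` X' = Inl ` (X \<inter> X')" "Inr ` Y \<inter> Inr ` Y' = Inr ` (Y \<inter> Y')"
    "Inl ` X \<inter> Inr ` Y = {}" "Inr ` Y \<inter> Inl ` X = {}" for X X' :: "'a set" and Y Y' :: "'b set"
    by auto
  have arcs: "(Inl x, Inl x') \<in> parcs ?U \<longleftrightarrow> (x, x') \<in> parcs G" "(Inr y, Inr y') \<in> parcs ?U \<longleftrightarrow> (y, y') \<in> parcs H"
    "(Inl x, Inr y) \<notin> parcs ?U" "(Inr y, Inl x) \<notin> parcs ?U" for x x' y y'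
    by (auto simp: graph_disjoint_union_def)
  have verts: "pverts ?U = pverts G <+> pverts H"
    by (simp add: graph_disjoint_union_def)
  have G: "real (card (nbrs G x \<inter> nbrs G y)) = 2 * s * of_bool ((x, y) \<in> parcs G) + (if x = y then c else 0)"
    if "x \<in> pverts G" "y \<in> pverts G" for x y
    using assms(1) that by (simp add: quadratic_graph_def)
  have H: "real (card (nbrs H x \<inter> nbrs H y)) = 2 * s * of_bool ((x, y) \<in> parcs H) + (if x = y then c else 0)"
    if "x \<in> pverts H" "y \<in> pverts H" for x y
    using assms(2) that by (simp add: quadratic_graph_def)
  show ?thesis
    unfolding quadratic_graph_def verts
  proof (intro ballI)
    fix z w assume "z \<in> pverts G <+> pverts H" "w \<in> pverts G <+> pverts H"
    then show "real (card (nbrs ?U z \<inter> nbrs ?U w)) = 2 * s * of_bool ((z, w) \<in> parcs ?U) + (if z = w then c else 0)"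
      by (cases z; cases w) (simp_all add: nbrs int arcs card_image G H Plus_def image_iff)
  qed
qed

lemma small_graph_simps:
  "pverts K1 = {0}" "parcs K1 = {}"
  "pverts K1_hat = {0}" "parcs K1_hat = {(0, 0)}"
  "pverts K2 = {0, 1}" "parcs K2 = {(0, 1), (1, 0)}"
  "pverts K2_hat = {0, 1}" "parcs K2_hat = {(0, 1), (1, 0), (0, 0), (1, 1)}"
  "pverts K2_tilde = {0, 1}" "parcs K2_tilde = {(0, 1), (1, 0), (0, 0)}"
  by (auto simp: K1_hat_def K2_hat_def K2_tilde_def attach_loops_def K1_def K2_def)

lemma nbrs_small:
  "nbrs K1 0 = {}" "nbrs K1_hat 0 = {0}"
  "nbrs K2 0 = {1}" "nbrs K2 1 = {0}"
  "nbrs K2_hat 0 = {0, 1}" "nbrs K2_hat 1 = {0, 1}"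
  "nbrs K2_tilde 0 = {0, 1}" "nbrs K2_tilde 1 = {0}"
  by (auto simp: nbrs_def small_graph_simps)

text \<open>With one vertex only a diagonal entry is constrained, so \<open>s\<close> stays free and
  determines \<open>c\<close>. With two vertices the off-diagonal entry fixes 2 s as the number of
  loops.\<close>

lemma quadratic_graph_small:
  "quadratic_graph s 0 K1" "quadratic_graph 0 1 K2"
  "quadratic_graph s (1 - 2 * s) K1_hat" "quadratic_graph (1 / 2) 1 K2_tilde"
  "quadratic_graph 1 0 K2_hat"
  by (simp_all add: quadratic_graph_def nbrs_small[unfolded One_nat_def] small_graph_simps)

section \<open>Recognising copies of a one- or two-vertex graph\<close>

lemma graph_copies_subset:
  assumes "parcs G \<subseteq> pverts G \<times> pverts G"
  shows "parcs (graph_copies k G) \<subseteq> pverts (graph_copies k G) \<times> pverts (graph_copies k G)"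
  using assms by (auto simp: graph_copies_def)

lemma graph_iso_copies_single:
  assumes "finite (pverts H)" "parcs H \<subseteq> pverts H \<times> pverts H"
    and T: "pverts T = {0 :: nat}" "parcs T \<subseteq> {0} \<times> {0}"
    and arcs: "\<And>x y. x \<in> pverts H \<Longrightarrow> y \<in> pverts H \<Longrightarrow> (x, y) \<in> parcs H \<longleftrightarrow> x = y \<and> (0, 0) \<in> parcs T"
  shows "graph_iso H (graph_copies (card (pverts H)) T)"
proof -
  obtain g where g: "bij_betw g (pverts H) {..<card (pverts H)}"
    using ex_bij_betw_finite_nat[OF assms(1)] by (auto simp: lessThan_atLeast0)
  show ?thesis
  proof (rule graph_isoI[where f = "\<lambda>x. (g x, 0)"])
    show "bij_betw (\<lambda>x. (g x, 0)) (pverts H) (pverts (graph_copies (card (pverts H)) T))"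
      using g by (auto simp: bij_betw_def graph_copies_def T(1) inj_on_def)
    fix x y assume "x \<in> pverts H" "y \<in> pverts H"
    with g arcs[OF this] show "(x, y) \<in> parcs H \<longleftrightarrow> ((g x, 0), (g y, 0)) \<in> parcs (graph_copies (card (pverts H)) T)"
      by (auto simp: graph_copies_def bij_betw_def inj_on_def)
  qed (use assms graph_copies_subset[of T] in auto)
qed

text \<open>\<open>p\<close> sends a vertex to its partner and \<open>R\<close> picks one vertex
  from each pair. An enumeration of \<open>R\<close> numbers the copies; the chosen vertex becomes
  vertex 0 of its copy and its partner vertex 1. With \<open>T\<close> left open, one argument
  covers \<open>K2\<close>, \<open>K2_tilde\<close> and \<open>K2_hat\<close>.\<close>

lemma graph_iso_copies_matching:
  assumes fin: "finite (pverts H)" and sub: "parcs H \<subseteq> pverts H \<times> pverts H"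
    and T: "pverts T = {0, 1 :: nat}" "parcs T \<subseteq> {0, 1} \<times> {0, 1}"
    and p: "\<And>x. x \<in> pverts H \<Longrightarrow> p x \<in> pverts H" "\<And>x. x \<in> pverts H \<Longrightarrow> p (p x) = x"
    and R: "R \<subseteq> pverts H" "\<And>x. x \<in> pverts H \<Longrightarrow> x \<in> R \<longleftrightarrow> p x \<notin> R"
    and arcs: "\<And>x y. x \<in> pverts H \<Longrightarrow> y \<in> pverts H \<Longrightarrow> (x, y) \<in> parcs H \<longleftrightarrow>
      (y = x \<or> y = p x) \<and> (if x \<in> R then 0 else 1, if y \<in> R then 0 else 1) \<in> parcs T"
  shows "even (card (pverts H))" "graph_iso H (graph_copies (card (pverts H) div 2) T)"
proof -
  let ?V = "pverts H" and ?k = "card R"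
  obtain g where g: "bij_betw g R {..<?k}"
    using ex_bij_betw_finite_nat[OF finite_subset[OF R(1) fin]] by (auto simp: lessThan_atLeast0)
  define f where "f x = (if x \<in> R then (g x, 0 :: nat) else (g (p x), 1))" for x
  define h where "h z = (let x = inv_into R g (fst z) in if snd z = 0 then x else p x)" for z :: "nat \<times> nat"
  have inv: "inv_into R g i \<in> R" "g (inv_into R g i) = i" if "i < ?k" for i
    using g that by (auto simp: bij_betw_def f_inv_into_f inv_into_into)
  have ginv: "inv_into R g (g x) = x" "g x < ?k" if "x \<in> R" for x
    using g that by (auto simp: bij_betw_def)
  have RV: "x \<in> ?V" and pnotR: "p x \<notin> R" if "x \<in> R" for x
    using that R by blast+
  have pR: "p x \<in> R" if "x \<in> ?V" "x \<notin> R" for x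
    using that R by blast
  have hR: "h (i, 0) = inv_into R g i" "h (i, Suc 0) = p (inv_into R g i)" for i
    by (simp_all add: h_def)
  have fR: "f x = (g x, 0)" "f (p x) = (g x, 1)" if "x \<in> R" for x
    using that by (simp_all add: f_def pnotR p RV)
  have fp: "f x = (g (p x), 1)" if "x \<in> ?V" "x \<notin> R" for x
    using that by (simp add: f_def)
  have bij: "bij_betw f ?V ({..<?k} \<times> {0, 1})"
  proof (rule bij_betw_byWitness[where f' = h])
    show "\<forall>x\<in>?V. h (f x) = x"
    proof
      fix x assume "x \<in> ?V"
      then show "h (f x) = x"
        by (cases "x \<in> R") (simp_all add: fR fp hR ginv pR p)
    qed
    show "\<forall>z\<in>{..<?k} \<times> {0, 1}. f (h z) = z"
      by (auto simp: hR fR inv)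
    show "f ` ?V \<subseteq> {..<?k} \<times> {0, 1}"
    proof
      fix z assume "z \<in> f ` ?V"
      then obtain x where "x \<in> ?V" "z = f x"
        by blast
      then show "z \<in> {..<?k} \<times> {0, 1}"
        by (cases "x \<in> R") (simp_all add: fR fp ginv pR)
    qed
    show "h ` ({..<?k} \<times> {0, 1}) \<subseteq> ?V"
      by (auto simp: hR inv RV p)
  qed
  then have card: "card ?V = 2 * ?k"
    using bij_betw_same_card by fastforce
  then show "even (card ?V)"
    by simp
  have "graph_iso H (graph_copies ?k T)"
  proof (rule graph_isoI[where f = f])
    show "bij_betw f ?V (pverts (graph_copies ?k T))"
      using bij by (simp add: graph_copies_def T)
    fix x y assume xy: "x \<in> ?V" "y \<in> ?V"
    have g_eq: "g a = g b \<longleftrightarrow> a = b" if "a \<in> R" "b \<in> R" for a b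
      using ginv(1) that by metis
    \<comment> \<open>An arc between copies of \<open>T\<close> means equal copy numbers and an arc
      of \<open>T\<close> between the labels. Equal copy numbers amount to lying in the same pair,
      which is the first conjunct of \<open>arcs\<close>; the labels give the second.\<close>
    have same: "fst (f x) = fst (f y) \<longleftrightarrow> y = x \<or> y = p x"
    proof (cases "x \<in> R"; cases "y \<in> R")
      assume "x \<in> R" "y \<in> R"
      then show ?thesis
        using pnotR by (auto simp: fR g_eq)
    next
      assume "x \<in> R" "y \<notin> R"
      then show ?thesis
        using xy p pnotR by (auto simp: fR fp g_eq pR)
    next
      assume "x \<notin> R" "y \<in> R"
      then show ?thesis
        using xy p pnotR by (auto simp: fR fp g_eq pR)
    next
      assume "x \<notin> R" "y \<notin> R"
      then show ?thesis
        using xy p pR by (auto simp: fp g_eq) metis+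
    qed
    have snd_f: "snd (f z) = (if z \<in> R then 0 else 1)" for z
      by (simp add: f_def)
    have bound: "fst (f x) < ?k"
      using bij_betwE[OF bij] xy(1) by force
    show "(x, y) \<in> parcs H \<longleftrightarrow> (f x, f y) \<in> parcs (graph_copies ?k T)"
      by (simp only: arcs[OF xy] in_parcs_graph_copies same snd_f bound simp_thms)
  qed (use T sub graph_copies_subset[of T] in auto)
  then show "graph_iso H (graph_copies (card ?V div 2) T)"
    by (simp add: card)
qed

text \<open>Symmetry and the absence of loops give each edge exactly two arcs.\<close>

lemma card_parcs_eq_num_edges:
  assumes "pair_graph G"
  shows "card (parcs G) = 2 * num_edges G"
proof -
  interpret pair_graph G by fact
  let ?F = "\<lambda>(x, y). {x, y}"
  have "card {a \<in> parcs G. ?F a = e} = 2" if e: "e \<in> ?F ` parcs G" for e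
  proof -
    obtain x y where xy: "(x, y) \<in> parcs G" "e = {x, y}"
      using e by auto
    then have "x \<noteq> y" "(y, x) \<in> parcs G"
      using no_loops' arcs_symmetric by blast+
    then have "{a \<in> parcs G. ?F a = e} = {(x, y), (y, x)}"
      using xy by (auto simp: doubleton_eq_iff)
    then show ?thesis
      using \<open>x \<noteq> y\<close> by simp
  qed
  then have "(\<Sum>e\<in>?F ` parcs G. card {a \<in> parcs G. ?F a = e}) = 2 * num_edges G"
    by (simp add: num_edges_def)
  moreover have "card (parcs G) = (\<Sum>e\<in>?F ` parcs G. card {a \<in> parcs G. ?F a = e})"
    using sum.image_gen[of "parcs G" "\<lambda>_. 1 :: nat" ?F] pair_finite_arcs by simp
  ultimately show ?thesis
    by simp
qed

section \<open>Graphs of extremal energy\<close>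

text \<open>Passage from spectra to counting. The equation \<open>(A - s I)\<^sup>2 = c I\<close> is
  \<open>A\<^sup>2 = 2 s A + (c - s\<^sup>2) I\<close>, and entries of \<open>A\<^sup>2\<close>
  count common neighbours. The shift of \<open>c\<close> is harmless because \<open>c\<close> is
  existentially quantified.\<close>

lemma energy_eq_iff_quadratic_graph:
  assumes G: "pair_graph G" and n: "n \<ge> 1" and v: "bij_betw v {..<n} (pverts G)" and S: "S \<subseteq> pverts G"
  shows "loop_energy v G S = sqrt (real n * (2 * real (num_edges G) + real (card S) - (real (card S))\<^sup>2 / real n)) \<longleftrightarrow>
    (\<exists>c. quadratic_graph (real (card S) / real n) c (attach_loops G S))"
proof -
  interpret pair_graph G by fact
  let ?V = "pverts G"
  define H where "H = attach_loops G S"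
  define A where "A = adjacency_matrix v H"
  define s where "s = real (card S) / real n"
  define M where "M = char_matrix A s"
  define a :: "nat \<Rightarrow> nat \<Rightarrow> real" where "a i j = of_bool ((v i, v j) \<in> parcs H)" for i j
  have H: "pverts H = ?V" "parcs H = parcs G \<union> Id_on S"
    by (simp_all add: H_def attach_loops_def)
  have card_V: "card ?V = n"
    using bij_betw_same_card[OF v] by simp
  have v_eq: "v i = v j \<longleftrightarrow> i = j" if "i < n" "j < n" for i j
    using v that by (auto simp: bij_betw_def inj_on_def)
  have V: "?V = v ` {..<n}"
    using v by (simp add: bij_betw_def)
  have sym: "(x, y) \<in> parcs H \<longleftrightarrow> (y, x) \<in> parcs H" for x y
    using arcs_symmetric by (auto simp: H)
  have a_sym: "a i j = a j i" for i j
    by (simp add: a_def sym)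
  have "(x, x) \<notin> parcs G" for x
    using no_loops' by blast
  then have a_diag: "a i i = of_bool (v i \<in> S)" for i
    by (simp add: a_def H Id_on_iff)
  have A: "A \<in> carrier_mat n n" "\<And>i j. i < n \<Longrightarrow> j < n \<Longrightarrow> A $$ (i, j) = a i j"
    by (auto simp: A_def adjacency_matrix_def H card_V a_def)
  have M: "M \<in> carrier_mat n n" "\<And>i j. i < n \<Longrightarrow> j < n \<Longrightarrow> M $$ (i, j) = a i j - (if i = j then s else 0)"
    using A by (simp_all add: M_def char_matrix_index[OF A(1)])
  have sum_V: "(\<Sum>k<n. f (v k)) = (\<Sum>x\<in>?V. f x)" for f :: "'a \<Rightarrow> real"
    by (rule sum.reindex_bij_betw[OF v])
  \<comment> \<open>Entries \<open>a i j\<close> are 0 or 1, hence equal to their squares; only the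
    diagonal acquires the correction from (a - s)^2 = a - 2 s a + s^2. Summed over the diagonal, the
    correction is n s^2 - 2 s \<sigma> = - \<sigma>^2 / n.\<close>
  have "(\<Sum>i<n. \<Sum>j<n. (M $$ (i, j))\<^sup>2) = (\<Sum>i<n. \<Sum>j<n. a i j + (if i = j then s\<^sup>2 - 2 * s * a i i else 0))"
    by (intro sum.cong refl) (auto simp: M a_def power2_eq_square algebra_simps)
  also have "\<dots> = (\<Sum>i<n. \<Sum>j<n. a i j) + (\<Sum>i<n. s\<^sup>2 - 2 * s * a i i)"
    by (simp add: sum.distrib)
  also have "(\<Sum>i<n. \<Sum>j<n. a i j) = (\<Sum>x\<in>?V. \<Sum>y\<in>?V. of_bool ((x, y) \<in> parcs H))"
    unfolding a_def sum_V[of "\<lambda>y. of_bool ((_, y) \<in> parcs H)"]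
    by (rule sum_V[of "\<lambda>x. \<Sum>y\<in>?V. of_bool ((x, y) \<in> parcs H)"])
  also have "\<dots> = (\<Sum>z\<in>?V \<times> ?V. of_bool (z \<in> parcs H))"
    by (simp only: sum.cartesian_product case_prod_unfold prod.collapse)
  also have "\<dots> = card (?V \<times> ?V \<inter> parcs H)"
    by (simp only: sum_of_bool_eq finite_cartesian_product pair_finite_verts Collect_mem_eq)
  also have "?V \<times> ?V \<inter> parcs H = parcs G \<union> Id_on S"
    using S by (auto simp: H wellformed')
  also have "card \<dots> = card (parcs G) + card (Id_on S)"
    using finite_subset[OF S pair_finite_verts] pair_finite_arcs no_loops'
    by (intro card_Un_disjoint) (auto simp: Id_on_def)
  also have "card (Id_on S) = card S"
    by (simp add: Id_on_def UNION_singleton_eq_range card_image inj_on_def)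
  also have "(\<Sum>i<n. s\<^sup>2 - 2 * s * a i i) = n * s\<^sup>2 - 2 * s * (\<Sum>i<n. of_bool (v i \<in> S))"
    by (simp add: sum_subtractf a_diag sum_distrib_left del: sum_of_bool_eq)
  also have "(\<Sum>i<n. of_bool (v i \<in> S)) = real (card (?V \<inter> S))"
    using sum_V[of "\<lambda>x. of_bool (x \<in> S)"] pair_finite_verts by (simp add: Int_def)
  also have "?V \<inter> S = S"
    using S by blast
  finally have norm: "(\<Sum>i<n. \<Sum>j<n. (M $$ (i, j))\<^sup>2) = 2 * real (num_edges G) + real (card S) - (real (card S))\<^sup>2 / real n"
    using n by (simp add: card_parcs_eq_num_edges[OF G] s_def power2_eq_square)
  have MM: "(M * M) $$ (i, j) = card (nbrs H (v i) \<inter> nbrs H (v j)) - 2 * s * a i j + (if i = j then s\<^sup>2 else 0)"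
    if ij: "i < n" "j < n" for i j
  proof -
    have "(M * M) $$ (i, j) = (\<Sum>k<n. M $$ (i, k) * M $$ (k, j))"
      by (rule index_mult_mat_sum[OF M(1,1) ij])
    also have "\<dots> = (\<Sum>k<n. a i k * a j k - (if k = i then s * a k j else 0) - (if k = j then s * a i k else 0)
        + (if k = i then if k = j then s\<^sup>2 else 0 else 0))"
      using ij by (intro sum.cong refl) (auto simp: M a_sym[of j] power2_eq_square algebra_simps)
    also have "\<dots> = (\<Sum>k<n. a i k * a j k) - 2 * s * a i j + (if i = j then s\<^sup>2 else 0)"
      using ij by (simp add: sum.distrib sum_subtractf)
    also have "(\<Sum>k<n. a i k * a j k) = (\<Sum>k<n. of_bool (v k \<in> nbrs H (v i) \<inter> nbrs H (v j)))"
      by (intro sum.cong refl) (auto simp: a_def nbrs_def H V)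
    also have "\<dots> = card {y \<in> ?V. y \<in> nbrs H (v i) \<inter> nbrs H (v j)}"
      unfolding sum_V[of "\<lambda>y. of_bool (y \<in> nbrs H (v i) \<inter> nbrs H (v j))"]
      using pair_finite_verts by (simp add: Int_def)
    also have "{y \<in> ?V. y \<in> nbrs H (v i) \<inter> nbrs H (v j)} = nbrs H (v i) \<inter> nbrs H (v j)"
      by (auto simp: nbrs_def H)
    finally show ?thesis .
  qed
  have "(\<forall>i<n. \<forall>j<n. (M * M) $$ (i, j) = (if i = j then c else 0)) \<longleftrightarrow> quadratic_graph s (c - s\<^sup>2) H" for c
  proof -
    have "(M * M) $$ (i, j) = (if i = j then c else 0) \<longleftrightarrow>
        real (card (nbrs H (v i) \<inter> nbrs H (v j))) =
          2 * s * of_bool ((v i, v j) \<in> parcs H) + (if v i = v j then c - s\<^sup>2 else 0)"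
      if "i < n" "j < n" for i j
      using that by (auto simp: MM v_eq a_def simp del: index_mult_mat(1) of_bool_eq_iff)
    then show ?thesis
      unfolding quadratic_graph_def H(1) V by (auto simp del: index_mult_mat(1))
  qed
  moreover have "quadratic_graph s (c + s\<^sup>2 - s\<^sup>2) H = quadratic_graph s c H" for c
    by simp
  ultimately have "(\<exists>c. \<forall>i<n. \<forall>j<n. (M * M) $$ (i, j) = (if i = j then c else 0)) \<longleftrightarrow> (\<exists>c. quadratic_graph s c H)"
    by metis
  moreover have "A $$ (i, j) = A $$ (j, i)" if "i < n" "j < n" for i j
    using that A(2) a_sym by simp
  ultimately show ?thesis
    using symmetric_eigenvalue_deviation[OF A(1) _ n, of s, folded M_def, unfolded norm]
    by (simp add: loop_energy_def card_V flip: H_def s_def A_def)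
qed

text \<open>
  Adjacent vertices have exactly \<open>2 s \<le> 2\<close> common neighbours, where the loops of the two vertices
  already count, and distinct non-adjacent vertices have none. So two neighbours of a vertex are
  adjacent, and the resulting triangle is impossible for \<open>s = 0\<close> and \<open>s = 1\<close>; for \<open>s = 1 / 2\<close> its
  vertices carry no loop, and by regularity every vertex lies in such a triangle.
\<close>

lemma quadratic_attach_loops_matching:
  assumes G: "pair_graph G" and S: "S \<subseteq> pverts G"
    and s: "s = real (card S) / real (card (pverts G))"
    and q: "quadratic_graph s c (attach_loops G S)" and ne: "parcs G \<noteq> {}"
  shows "s \<in> {0, 1 / 2, 1}" "\<And>x. x \<in> pverts G \<Longrightarrow> \<exists>y. nbrs G x = {y}"
proof -
  interpret pair_graph G by fact
  let ?V = "pverts G" and ?H = "attach_loops G S"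
  have finS: "finite S"
    using S pair_finite_verts by (rule finite_subset)
  have arcs_H: "(x, y) \<in> parcs ?H \<longleftrightarrow> (x, y) \<in> parcs G \<or> x = y \<and> x \<in> S" for x y
    by (auto simp: attach_loops_def)
  have nbrs_H: "nbrs ?H x = nbrs G x \<union> ({x} \<inter> S)" for x
    using S by (auto simp: nbrs_def attach_loops_def)
  have quad: "real (card (nbrs ?H x \<inter> nbrs ?H y)) = 2 * s * of_bool ((x, y) \<in> parcs ?H) + (if x = y then c else 0)"
    if "x \<in> ?V" "y \<in> ?V" for x y
    using q that by (simp add: quadratic_graph_def attach_loops_def[THEN arg_cong[of _ _ pverts]])
  have fin: "finite (nbrs G x)" for x
    using pair_finite_verts by (simp add: nbrs_def)
  have sym: "y \<in> nbrs G x \<Longrightarrow> x \<in> nbrs G y" for x y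
    using arcs_symmetric by (auto simp: nbrs_def wellformed')
  have irr: "x \<notin> nbrs G x" for x
    using no_loops' by (auto simp: nbrs_def)
  have inV: "x \<in> ?V" "y \<in> ?V" if "y \<in> nbrs G x" for x y
    using that by (auto simp: nbrs_def wellformed')
  have adj: "real (card (nbrs ?H x \<inter> nbrs ?H y)) = 2 * s" if "y \<in> nbrs G x" for x y
  proof -
    have "x \<noteq> y" "(x, y) \<in> parcs G"
      using that irr by (auto simp: nbrs_def)
    with quad[OF inV[OF that]] show ?thesis
      by (simp add: arcs_H)
  qed
  have nonadj: "nbrs ?H x \<inter> nbrs ?H y = {}" if "y \<notin> nbrs G x" "x \<noteq> y" "x \<in> ?V" "y \<in> ?V" for x y
  proof -
    have "(x, y) \<notin> parcs G"
      using that by (auto simp: nbrs_def)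
    with quad[OF that(3,4)] that(2) have "card (nbrs ?H x \<inter> nbrs ?H y) = 0"
      by (simp add: arcs_H)
    moreover have "finite (nbrs ?H x \<inter> nbrs ?H y)"
      by (simp add: nbrs_H fin)
    ultimately show ?thesis
      by (simp only: card_0_eq)
  qed
  \<comment> \<open>A loop at \<open>x\<close> adds 2 s to the right side of the diagonal equation
    and 1 to the neighbour count, whence the coefficient 2 s - 1.\<close>
  have diag: "real (card (nbrs G x)) = (2 * s - 1) * of_bool (x \<in> S) + c" if "x \<in> ?V" for x
  proof -
    have "(x, x) \<notin> parcs G"
      using no_loops' by blast
    then have "real (card (nbrs ?H x)) = 2 * s * of_bool (x \<in> S) + c"
      using quad[OF that that] \<open>(x, x) \<notin> parcs G\<close> by (simp add: arcs_H)
    moreover have "card (nbrs ?H x) = card (nbrs G x) + of_bool (x \<in> S)"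
      using irr[of x] fin by (cases "x \<in> S") (simp_all add: nbrs_H)
    ultimately show ?thesis
      by (cases "x \<in> S") simp_all
  qed
  obtain x0 y0 where x0: "y0 \<in> nbrs G x0"
    using ne by (fastforce simp: nbrs_def dest: in_arcsD2)
  have V0: "card ?V > 0"
    using x0 inV pair_finite_verts by (auto simp: card_gt_0_iff)
  have "card S \<le> card ?V"
    using S pair_finite_verts by (rule card_mono[rotated])
  then have "2 * s \<le> 2"
    using V0 by (simp add: s field_simps)
  \<comment> \<open>Since an edge exists, 2 s is a cardinality; being at most 2, it is 0, 1 or
    2.\<close>
  with adj[OF x0] have "card (nbrs ?H x0 \<inter> nbrs ?H y0) \<le> 2"
    by linarith
  then have "card (nbrs ?H x0 \<inter> nbrs ?H y0) = 0 \<or> card (nbrs ?H x0 \<inter> nbrs ?H y0) = 1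
      \<or> card (nbrs ?H x0 \<inter> nbrs ?H y0) = 2"
    by linarith
  with adj[OF x0] show s3: "s \<in> {0, 1 / 2, 1}"
    by auto
  have S0: "S = {}" if "s = 0"
    using that V0 finS by (auto simp: s)
  have S1: "S = ?V" if "s = 1"
    using that V0 S pair_finite_verts by (intro card_subset_eq) (auto simp: s field_simps)
  \<comment> \<open>The loop term in \<open>diag\<close> is the same at all vertices: for s = 1/2
    its coefficient is 0, and otherwise \<open>S\<close> is empty or everything. So \<open>G\<close>
    is regular.\<close>
  have const: "card (nbrs G x) = card (nbrs G y)" if "x \<in> ?V" "y \<in> ?V" for x y
  proof -
    have "(2 * s - 1) * of_bool (x \<in> S) = (2 * s - 1) * of_bool (y \<in> S)"
      using s3 S0 S1 that by auto
    with diag[OF that(1)] diag[OF that(2)] show ?thesis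
      by simp
  qed
  have triangle: "s = 1 / 2 \<and> x \<notin> S" if yz: "y \<in> nbrs G x" "z \<in> nbrs G x" "y \<noteq> z" for x y z
  proof -
    have "x \<in> nbrs ?H y \<inter> nbrs ?H z"
      using yz sym by (auto simp: nbrs_H)
    then have "z \<in> nbrs G y"
      using nonadj[of z y] yz inV by blast
    \<comment> \<open>Besides \<open>z\<close>, each looped end of the edge from \<open>x\<close> to
      \<open>y\<close> is a common neighbour, so 2 s is at least 1 plus the number of loops at
      \<open>x\<close> and \<open>y\<close>. This excludes s = 0, excludes s = 1, where the bound is
      3, and for s = 1/2 forbids a loop at \<open>x\<close>.\<close>
    then have sub: "{z} \<union> ({x, y} \<inter> S) \<subseteq> nbrs ?H x \<inter> nbrs ?H y"
      using yz sym by (auto simp: nbrs_H)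
    have "card ({z} \<union> ({x, y} \<inter> S)) \<le> card (nbrs ?H x \<inter> nbrs ?H y)"
      by (rule card_mono[OF _ sub]) (simp add: nbrs_H fin)
    then have le: "real (card ({z} \<union> ({x, y} \<inter> S))) \<le> 2 * s"
      using adj[OF yz(1)] by linarith
    have ne: "x \<noteq> y" "x \<noteq> z"
      using yz irr by auto
    have "card ({z} \<union> ({x, y} \<inter> S)) \<noteq> 0"
      by (subst card_0_eq) auto
    then have "s \<noteq> 0"
      using le by auto
    moreover have "s \<noteq> 1"
    proof
      assume "s = 1"
      then have "{x, y} \<inter> S = {x, y}"
        using S1 inV[OF yz(1)] by auto
      then show False
        using le ne yz \<open>s = 1\<close> by simp
    qed
    ultimately have "s = 1 / 2"
      using s3 by auto
    moreover have "x \<notin> S"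
    proof
      assume "x \<in> S"
      then have "card {z, x} \<le> card ({z} \<union> ({x, y} \<inter> S))"
        by (intro card_mono) auto
      then show False
        using le ne \<open>s = 1 / 2\<close> by simp
    qed
    ultimately show ?thesis ..
  qed
  fix x assume x: "x \<in> ?V"
  have "card (nbrs G x) \<ge> 1"
    using const[OF x inV(1)[OF x0]] x0 fin[of x0] by (auto simp: Suc_le_eq card_gt_0_iff)
  moreover have "\<not> card (nbrs G x) \<ge> 2"
  proof
    assume "card (nbrs G x) \<ge> 2"
    then have "card (nbrs G w) \<ge> 2" if "w \<in> ?V" for w
      using const[OF x that] by simp
    then have "\<exists>y z. y \<in> nbrs G w \<and> z \<in> nbrs G w \<and> y \<noteq> z" if "w \<in> ?V" for w
      using that by (meson card_2_iff' obtain_subset_with_card_n subsetD)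
    then have "s = 1 / 2 \<and> w \<notin> S" if "w \<in> ?V" for w
      using that triangle by blast
    \<comment> \<open>Without any loop \<open>s\<close> would be 0, which contradicts s =
      1/2.\<close>
    then have "s = 1 / 2" "S = {}"
      using x S by auto
    then show False
      by (simp add: s)
  qed
  ultimately have "card (nbrs G x) = 1"
    by linarith
  then show "\<exists>y. nbrs G x = {y}"
    by (simp add: card_1_singleton_iff)
qed

section \<open>Classification of the extremal graphs\<close>

lemma graph_iso_isolated:
  assumes fin: "finite (pverts H)" and S: "S \<subseteq> pverts H" and arcs: "parcs H = Id_on S"
  shows "graph_iso H (graph_disjoint_union (graph_copies (card (pverts H - S)) K1) (graph_copies (card S) K1_hat))"
    (is "graph_iso H ?U")
proof -
  obtain g where g: "bij_betw g S {..<card S}"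
    using ex_bij_betw_finite_nat[OF finite_subset[OF S fin]] by (auto simp: lessThan_atLeast0)
  obtain h where h: "bij_betw h (pverts H - S) {..<card (pverts H - S)}"
    using ex_bij_betw_finite_nat[of "pverts H - S"] fin by (auto simp: lessThan_atLeast0)
  define f where "f x = (if x \<in> S then Inr (g x, 0 :: nat) else Inl (h x, 0 :: nat))" for x
  have "bij_betw f (pverts H - S) (({..<card (pverts H - S)} \<times> {0}) <+> {})"
    using h by (auto simp: bij_betw_def inj_on_def f_def image_iff)
  moreover have "bij_betw f S ({} <+> ({..<card S} \<times> {0}))"
    using g by (auto simp: bij_betw_def inj_on_def f_def image_iff)
  ultimately have "bij_betw f (pverts H - S \<union> S)
      ((({..<card (pverts H - S)} \<times> {0}) <+> {}) \<union> ({} <+> ({..<card S} \<times> {0})))"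
    by (rule bij_betw_combine) auto
  moreover have "pverts H - S \<union> S = pverts H"
    using S by blast
  moreover have "pverts ?U = (({..<card (pverts H - S)} \<times> {0}) <+> {}) \<union> ({} <+> ({..<card S} \<times> {0}))"
    by (auto simp: graph_disjoint_union_def graph_copies_def small_graph_simps)
  ultimately have bij: "bij_betw f (pverts H) (pverts ?U)"
    by simp
  show ?thesis
  proof (rule graph_isoI[OF _ _ bij])
    show "parcs H \<subseteq> pverts H \<times> pverts H"
      using S by (auto simp: arcs)
    show "parcs ?U \<subseteq> pverts ?U \<times> pverts ?U"
      by (auto simp: graph_disjoint_union_def graph_copies_def small_graph_simps)
    fix x y
    have "(g x = g y) = (x = y)" if "x \<in> S" "y \<in> S"
      using that g by (auto simp: bij_betw_def inj_on_def)
    moreover have "g x < card S" if "x \<in> S"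
      using bij_betwE[OF g] that by auto
    ultimately show "(x, y) \<in> parcs H \<longleftrightarrow> (f x, f y) \<in> parcs ?U"
      by (auto simp: arcs f_def graph_disjoint_union_def graph_copies_def small_graph_simps image_iff)
  qed
qed

text \<open>An injective numbering \<open>u\<close> breaks the symmetry within each pair: the vertex
  with the smaller number is chosen.\<close>

lemma involution_transversal:
  fixes u :: "'a \<Rightarrow> nat"
  assumes "inj_on u V" "\<And>x. x \<in> V \<Longrightarrow> p x \<in> V" "\<And>x. x \<in> V \<Longrightarrow> p (p x) = x" "\<And>x. x \<in> V \<Longrightarrow> p x \<noteq> x"
    and "x \<in> V"
  shows "x \<in> {x \<in> V. u x < u (p x)} \<longleftrightarrow> p x \<notin> {x \<in> V. u x < u (p x)}"
proof -
  have "u x \<noteq> u (p x)"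
    using assms by (metis inj_onD)
  then show ?thesis
    using assms by auto
qed

lemma quadratic_attach_loops_cases:
  fixes G :: "'a pair_pre_digraph"
  assumes G: "pair_graph G" and S: "S \<subseteq> pverts G" and n: "n = card (pverts G)" "n \<ge> 1"
    and s: "s = real (card S) / real n"
    and q: "quadratic_graph s c (attach_loops G S)"
  defines "H \<equiv> attach_loops G S"
  shows "(card S = 0 \<and>
       (graph_iso H (graph_copies n K1) \<or> even n \<and> graph_iso H (graph_copies (n div 2) K2))) \<or>
    (real (card S) = real n / 2 \<and> even n \<and>
       (graph_iso H (graph_disjoint_union (graph_copies (n div 2) K1) (graph_copies (n div 2) K1_hat)) \<or>
        graph_iso H (graph_copies (n div 2) K2_tilde))) \<or>
    (card S = n \<and>
       (graph_iso H (graph_copies n K1_hat) \<or> even n \<and> graph_iso H (graph_copies (n div 2) K2_hat)))"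
proof -
  interpret pair_graph G by fact
  have finV: "finite (pverts G)"
    by (rule pair_finite_verts)
  have finS: "finite S"
    using S finV by (rule finite_subset)
  have S_empty: "S = {}" if "card S = 0"
    using that finS by simp
  have S_full: "S = pverts G" if "card S = n"
    using that finV S n by (intro card_subset_eq) auto
  have V_H: "pverts H = pverts G"
    by (simp add: H_def attach_loops_def)
  have arcs_H: "(x, y) \<in> parcs H \<longleftrightarrow> (x, y) \<in> parcs G \<or> x = y \<and> x \<in> S" for x y
    by (auto simp: H_def attach_loops_def)
  have sub_H: "parcs H \<subseteq> pverts H \<times> pverts H"
    using S by (auto simp: H_def attach_loops_def wellformed')
  have quad: "real (card (nbrs H x \<inter> nbrs H y)) = 2 * s * of_bool ((x, y) \<in> parcs H) + (if x = y then c else 0)"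
    if "x \<in> pverts G" "y \<in> pverts G" for x y
    using q that by (simp add: quadratic_graph_def V_H flip: H_def)
  note fin_H = finV[folded V_H]
  show ?thesis
  proof (cases "parcs G = {}")
    case empty: True
    then have arcs_S: "parcs H = Id_on S"
      by (simp add: H_def attach_loops_def)
    consider "S = {}" | "S = pverts G" | "S \<noteq> {}" "S \<noteq> pverts G"
      by blast
    then show ?thesis
    proof cases
      case 1
      have "graph_iso H (graph_copies (card (pverts H)) K1)"
        by (rule graph_iso_copies_single[OF fin_H sub_H]) (auto simp: arcs_S 1 small_graph_simps)
      then show ?thesis
        using 1 by (simp add: V_H n)
    next
      case 2
      have "graph_iso H (graph_copies (card (pverts H)) K1_hat)"
        by (rule graph_iso_copies_single[OF fin_H sub_H]) (auto simp: arcs_S 2 V_H small_graph_simps)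
      then show ?thesis
        using 2 by (simp add: V_H n)
    next
      case 3
      then obtain x y where x: "x \<in> S" "x \<in> pverts G" and y: "y \<notin> S" "y \<in> pverts G"
        using S by blast
      have "nbrs H x = {x}" "nbrs H y = {}"
        using x y by (auto simp: nbrs_def arcs_S V_H)
      \<comment> \<open>The diagonal equations at a looped and at a bare vertex. Together they give
        s = 1/2, so exactly half of the vertices are looped.\<close>
      then have "1 = 2 * s + c" "c = 0"
        using quad[OF x(2) x(2)] quad[OF y(2) y(2)] x(1) y(1) by (auto simp: arcs_S Id_on_iff)
      then have "n = 2 * card S"
        using s n by (simp add: field_simps)
      moreover have "card (pverts H - S) = n - card S"
        using S finS by (simp add: card_Diff_subset V_H n)
      moreover have "graph_iso H (graph_disjoint_union (graph_copies (card (pverts H - S)) K1) (graph_copies (card S) K1_hat))"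
        using S by (intro graph_iso_isolated fin_H arcs_S) (simp add: V_H)
      ultimately show ?thesis
        by auto
    qed
  next
    case False
    have s': "s = real (card S) / real (card (pverts G))"
      using s n(1) by simp
    note s3 = quadratic_attach_loops_matching(1)[OF G S s' q False]
    have single: "\<exists>y. nbrs G x = {y}" if "x \<in> pverts G" for x
      by (rule quadratic_attach_loops_matching(2)[OF G S s' q False that])
    define p where "p x = the_elem (nbrs G x)" for x
    have nbrs_p: "nbrs G x = {p x}" if x: "x \<in> pverts G" for x
    proof -
      obtain y where "nbrs G x = {y}"
        using single[OF x] by blast
      then show ?thesis
        by (simp add: p_def)
    qed
    have arcs_p: "(x, y) \<in> parcs G \<longleftrightarrow> y = p x" if "x \<in> pverts G" "y \<in> pverts G" for x y
      using nbrs_p[OF that(1)] that(2) by (auto simp: nbrs_def)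
    have p_V: "p x \<in> pverts G" if "x \<in> pverts G" for x
      using nbrs_p[OF that] by (auto simp: nbrs_def)
    have p_p: "p (p x) = x" if "x \<in> pverts G" for x
    proof -
      have "(p x, x) \<in> parcs G"
        using arcs_p[OF that p_V[OF that]] arcs_symmetric by blast
      then show ?thesis
        using arcs_p[OF p_V[OF that] that] by simp
    qed
    have p_neq: "p x \<noteq> x" if "x \<in> pverts G" for x
      using arcs_p[OF that that] no_loops' by metis
    obtain u :: "'a \<Rightarrow> nat" where u: "inj_on u (pverts G)"
      using finite_imp_inj_to_nat_seg[OF finV] by blast
    define R where "R = {x \<in> pverts G. u x < u (p x)}"
    have R: "R \<subseteq> pverts G" "\<And>x. x \<in> pverts G \<Longrightarrow> x \<in> R \<longleftrightarrow> p x \<notin> R"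
      unfolding R_def using involution_transversal[OF u p_V p_p p_neq] by blast+
    \<comment> \<open>\<open>Q\<close> decides which end of an edge becomes vertex 0. For
      \<open>K2\<close> and \<open>K2_hat\<close>, where the ends are interchangeable, the
      transversal \<open>R\<close> serves; for \<open>K2_tilde\<close> it has to be
      \<open>S\<close>, since the loop sits at vertex 0.\<close>
    have matching: "even n \<and> graph_iso H (graph_copies (n div 2) T)"
      if T: "pverts T = {0, 1 :: nat}" "parcs T \<subseteq> {0, 1} \<times> {0, 1}"
        and Q: "Q \<subseteq> pverts G" "\<And>x. x \<in> pverts G \<Longrightarrow> x \<in> Q \<longleftrightarrow> p x \<notin> Q"
        and TQ: "\<And>x y. x \<in> pverts G \<Longrightarrow> y \<in> pverts G \<Longrightarrow> y = p x \<or> x = y \<and> x \<in> S \<longleftrightarrow>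
          (y = x \<or> y = p x) \<and> (if x \<in> Q then 0 else 1, if y \<in> Q then 0 else 1) \<in> parcs T"
      for T Q
    proof -
      have arcs: "(x, y) \<in> parcs H \<longleftrightarrow>
          (y = x \<or> y = p x) \<and> (if x \<in> Q then 0 else 1, if y \<in> Q then 0 else 1) \<in> parcs T"
        if "x \<in> pverts G" "y \<in> pverts G" for x y
        unfolding arcs_H arcs_p[OF that] by (rule TQ[OF that])
      note iso = graph_iso_copies_matching[OF fin_H sub_H T(1,2), unfolded V_H, OF p_V p_p Q arcs]
      show ?thesis
        using iso by (simp add: n(1))
    qed
    from s3 consider "s = 0" | "s = 1 / 2" | "s = 1"
      by blast
    then show ?thesis
    proof cases
      case 1
      then have S0: "card S = 0"
        using s n(2) by simp
      have "even n \<and> graph_iso H (graph_copies (n div 2) K2)"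
      proof (rule matching[OF _ _ R])
        fix x y assume "x \<in> pverts G" "y \<in> pverts G"
        then show "y = p x \<or> x = y \<and> x \<in> S \<longleftrightarrow>
            (y = x \<or> y = p x) \<and> (if x \<in> R then 0 else 1, if y \<in> R then 0 else 1) \<in> parcs K2"
          using R(2)[of x] p_neq[of x] by (auto simp: small_graph_simps S_empty[OF S0])
      qed (simp_all add: small_graph_simps)
      then show ?thesis
        using S0 by blast
    next
      case 2
      \<comment> \<open>Adjacent vertices have 2 s = 1 common neighbour. In a matching only
        \<open>x\<close> and \<open>p x\<close> themselves can be common neighbours, each exactly
        when it carries a loop; so every edge has exactly one looped end and \<open>S\<close> is a
        transversal.\<close>
      have "real (card (nbrs H x \<inter> nbrs H (p x))) = 1" if "x \<in> pverts G" for x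
        using quad[OF that p_V[OF that]] that by (simp add: 2 arcs_H arcs_p p_V p_neq[THEN not_sym])
      moreover have "nbrs H x \<inter> nbrs H (p x) = {x, p x} \<inter> S" if "x \<in> pverts G" for x
      proof -
        have N: "nbrs H x = {p x} \<union> ({x} \<inter> S)" if "x \<in> pverts G" for x
          using that p_V[OF that] arcs_p by (auto simp: nbrs_def V_H arcs_H)
        show ?thesis
          unfolding N[OF that] N[OF p_V[OF that]] p_p[OF that] using p_neq[OF that] by auto
      qed
      ultimately have card1: "card ({x, p x} \<inter> S) = 1" if "x \<in> pverts G" for x
        using that by (metis of_nat_eq_1_iff)
      have S_p: "x \<in> S \<longleftrightarrow> p x \<notin> S" if "x \<in> pverts G" for x
        using card1[OF that] p_neq[OF that] by (cases "x \<in> S"; cases "p x \<in> S") auto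
      have "even n \<and> graph_iso H (graph_copies (n div 2) K2_tilde)"
      proof (rule matching[OF _ _ S S_p])
        fix x y assume "x \<in> pverts G" "y \<in> pverts G"
        then show "y = p x \<or> x = y \<and> x \<in> S \<longleftrightarrow>
            (y = x \<or> y = p x) \<and> (if x \<in> S then 0 else 1, if y \<in> S then 0 else 1) \<in> parcs K2_tilde"
          using S_p[of x] p_neq[of x] by (auto simp: small_graph_simps)
      qed (simp_all add: small_graph_simps)
      moreover have "real (card S) = real n / 2"
        using s 2 n(2) by (simp add: field_simps)
      ultimately show ?thesis
        by blast
    next
      case 3
      then have S1: "card S = n"
        using s n(2) by simp
      have "even n \<and> graph_iso H (graph_copies (n div 2) K2_hat)"
      proof (rule matching[OF _ _ R])
        fix x y assume "x \<in> pverts G" "y \<in> pverts G"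
        then show "y = p x \<or> x = y \<and> x \<in> S \<longleftrightarrow>
            (y = x \<or> y = p x) \<and> (if x \<in> R then 0 else 1, if y \<in> R then 0 else 1) \<in> parcs K2_hat"
          using R(2)[of x] p_neq[of x] by (auto simp: small_graph_simps S_full[OF S1])
      qed (simp_all add: small_graph_simps)
      then show ?thesis
        using S1 by blast
    qed
  qed
qed

theorem theorem4:
  fixes G :: "'a pair_pre_digraph" and S :: "'a set" and v :: "nat \<Rightarrow> 'a" and n m \<sigma> :: nat
  assumes "pair_graph G"
    and "n \<ge> 1"
    and "bij_betw v {..<n} (pverts G)"
    and "m = num_edges G"
    and "S \<subseteq> pverts G"
    and "\<sigma> = card S"
  shows "loop_energy v G S = sqrt (real n * (2 * real m + real \<sigma> - (real \<sigma>)\<^sup>2 / real n)) \<longleftrightarrow>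
    (\<sigma> = 0 \<and>
       (graph_iso (attach_loops G S) (graph_copies n K1) \<or>
        even n \<and> graph_iso (attach_loops G S) (graph_copies (n div 2) K2))) \<or>
    (real \<sigma> = real n / 2 \<and> even n \<and>
       (graph_iso (attach_loops G S)
          (graph_disjoint_union (graph_copies (n div 2) K1) (graph_copies (n div 2) K1_hat)) \<or>
        graph_iso (attach_loops G S) (graph_copies (n div 2) K2_tilde))) \<or>
    (\<sigma> = n \<and>
       (graph_iso (attach_loops G S) (graph_copies n K1_hat) \<or>
        even n \<and> graph_iso (attach_loops G S) (graph_copies (n div 2) K2_hat)))"
    (is "?energy \<longleftrightarrow> ?graphs")
proof -
  define H where "H = attach_loops G S"
  define s where "s = real \<sigma> / real n"
  have n: "n = card (pverts G)"
    using bij_betw_same_card[OF assms(3)] by simp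
  interpret pair_graph G by fact
  have sub: "parcs H \<subseteq> pverts H \<times> pverts H"
    using assms(5) by (auto simp: H_def attach_loops_def wellformed')
  have energy: "?energy \<longleftrightarrow> (\<exists>c. quadratic_graph s c H)"
    using energy_eq_iff_quadratic_graph[OF assms(1,2,3,5)] by (simp add: H_def s_def assms(4,6))
  have s_zero: "s = 0" if "\<sigma> = 0"
    using that by (simp add: s_def)
  have s_half: "s = 1 / 2" if "real \<sigma> = real n / 2"
    using that assms(2) by (simp add: s_def)
  have s_one: "s = 1" if "\<sigma> = n"
    using that assms(2) by (simp add: s_def)
  have K1_hat_half: "quadratic_graph (1 / 2) 0 K1_hat"
    using quadratic_graph_small(3)[of "1 / 2"] by simp
  note iso = quadratic_graph_iso[OF _ sub]
  note copies = quadratic_graph_copies quadratic_graph_disjoint_union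
  \<comment> \<open>Each listed graph is assembled from small graphs that satisfy the condition for
    the value of \<open>s\<close> given by \<sigma>. In the mixed edgeless case
    \<open>K1_hat_half\<close> supplies the constant 0 that \<open>K1\<close> has.\<close>
  have "\<exists>c. quadratic_graph s c H" if ?graphs
    using that unfolding H_def[symmetric]
  proof (elim disjE conjE)
    assume "\<sigma> = 0" "graph_iso H (graph_copies n K1)"
    then show ?thesis
      using iso copies quadratic_graph_small(1) by blast
  next
    assume "\<sigma> = 0" "graph_iso H (graph_copies (n div 2) K2)"
    then show ?thesis
      using iso copies quadratic_graph_small(2) s_zero by metis
  next
    assume "real \<sigma> = real n / 2"
      "graph_iso H (graph_disjoint_union (graph_copies (n div 2) K1) (graph_copies (n div 2) K1_hat))"
    then show ?thesis
      using iso copies quadratic_graph_small(1) K1_hat_half s_half by metis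
  next
    assume "real \<sigma> = real n / 2" "graph_iso H (graph_copies (n div 2) K2_tilde)"
    then show ?thesis
      using iso copies quadratic_graph_small(4) s_half by metis
  next
    assume "\<sigma> = n" "graph_iso H (graph_copies n K1_hat)"
    then show ?thesis
      using iso copies quadratic_graph_small(3) by blast
  next
    assume "\<sigma> = n" "graph_iso H (graph_copies (n div 2) K2_hat)"
    then show ?thesis
      using iso copies quadratic_graph_small(5) s_one by metis
  qed
  moreover have ?graphs if "\<exists>c. quadratic_graph s c H"
  proof -
    from that obtain c where "quadratic_graph s c (attach_loops G S)"
      by (auto simp: H_def)
    from quadratic_attach_loops_cases[OF assms(1,5) n assms(2) _ this] show ?thesis
      by (simp add: s_def assms(6))
  qed
  ultimately show ?thesis
    unfolding energy by blast
qed

end
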